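(* Let $(G,A,\rho,\pi)$ be a bijective cocycle datum. Define $T:A\to A$ by $$T(x)=\rho(\pi^{-1}(x))(x),\qquad x\in A.$$ Then the pair $(A,T)$ is a $T$-structure.
   Context: A bijective cocycle datum is a quadruple $(G,A,\rho,\pi)$ where $G$ is a group, $A$ is a $G$-module (abelian group) with the $G$-action given by a homomorphism $\rho:G\to\mathrm{Aut}(A)$, and $\pi:G\to A$ is a bijective 1-cocycle, i.e. a bijection with $\pi(g_1g_2)=\rho(g_2)^{-1}\pi(g_1)+\pi(g_2)$ for all $g_1,g_2\in G$. A $T$-structure is a pair $(A,T)$ of an abelian group $A$ and a bijective map $T:A\to A$ such that $T(kx)=kT^k(x)$ for all $x\in A$ and $k\in\mathbb{Z}$ (here $T^k$ is the $k$-th iterate of $T$, with $T^{-1}$ the inverse map for negative $k$). *)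

theory Defs
  imports "HOL-Algebra.Bij"
begin

text \<open>
  Abelian groups are commutative groups of HOL-Algebra, hence written multiplicatively:
  \<open>x \<otimes>\<^bsub>A\<^esub> y\<close> stands for \<open>x + y\<close>, and \<open>x [^]\<^bsub>A\<^esub> (k :: int)\<close> for \<open>k x\<close>.
\<close>

text \<open>
  The product of \<open>AutoGroup A\<close> is composition of functions, so a homomorphism into it is a
  left action by automorphisms.
\<close>

locale bijective_cocycle_datum = G: group G + A: comm_group A
  for G :: "('g, 'c) monoid_scheme" (structure) and A :: "('a, 'd) monoid_scheme" (structure) +
  fixes \<rho> :: "'g \<Rightarrow> 'a \<Rightarrow> 'a" and \<pi> :: "'g \<Rightarrow> 'a"
  assumes action: "\<rho> \<in> hom G (AutoGroup A)"
    and bij: "bij_betw \<pi> (carrier G) (carrier A)"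
    and cocycle: "\<lbrakk>g1 \<in> carrier G; g2 \<in> carrier G\<rbrakk> \<Longrightarrow>
      \<pi> (g1 \<otimes>\<^bsub>G\<^esub> g2) = (inv\<^bsub>AutoGroup A\<^esub> (\<rho> g2)) (\<pi> g1) \<otimes>\<^bsub>A\<^esub> \<pi> g2"

definition int_iterate :: "'a set \<Rightarrow> ('a \<Rightarrow> 'a) \<Rightarrow> int \<Rightarrow> 'a \<Rightarrow> 'a" where
  "int_iterate S T k =
    (if 0 \<le> k then T ^^ nat k else (inv_into S T) ^^ nat (- k))"

locale T_structure = A: comm_group A
  for A :: "('a, 'd) monoid_scheme" (structure) +
  fixes T :: "'a \<Rightarrow> 'a"
  assumes bij: "bij_betw T (carrier A) (carrier A)"
    and T_pow: "x \<in> carrier A \<Longrightarrow>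
      T (x [^]\<^bsub>A\<^esub> (k :: int)) = int_iterate (carrier A) T k x [^]\<^bsub>A\<^esub> k"

definition cocycle_T ::
  "('g, 'c) monoid_scheme \<Rightarrow> ('g \<Rightarrow> 'a \<Rightarrow> 'a) \<Rightarrow> ('g \<Rightarrow> 'a) \<Rightarrow> 'a \<Rightarrow> 'a" where
  "cocycle_T G \<rho> \<pi> x = \<rho> (inv_into (carrier G) \<pi> x) x"

end

theory Submission
  imports Defs
begin

text \<open>
  Two consequences of the cocycle identity carry the proof. Put \<open>g = \<pi>\<^sup>-\<^sup>1(x)\<close>.

  Since \<open>\<pi>(1) = 0\<close>, expanding \<open>\<pi>(g g\<^sup>-\<^sup>1)\<close> gives \<open>\<pi>(g\<^sup>-\<^sup>1) = - \<rho>(g)(\<pi>(g)) = - T(x)\<close>.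
  Thus \<open>T\<close> is inversion in \<open>G\<close>, transported along \<open>\<pi>\<close>, followed by negation in \<open>A\<close>; so it is
  bijective (lemma \<open>bij_T\<close>).

  Since \<open>\<rho>(h)\<close> is additive, \<open>T(k x) = k \<rho>(\<pi>\<^sup>-\<^sup>1(k x))(x)\<close>, and it remains to identify
  the orbit \<open>y\<^sub>k = \<rho>(\<pi>\<^sup>-\<^sup>1(k x))(x)\<close> with \<open>T\<^sup>k(x)\<close>. The cocycle identity, read as a formula
  for \<open>\<pi>\<^sup>-\<^sup>1\<close> of a sum, is \<open>\<pi>\<^sup>-\<^sup>1(x + b) = \<pi>\<^sup>-\<^sup>1(\<rho>(h)(x)) h\<close> with \<open>h = \<pi>\<^sup>-\<^sup>1(b)\<close>.
  Letting both sides act on \<open>x\<close>, for \<open>b = k x\<close>, gives \<open>y\<^sub>k\<^sub>+\<^sub>1 = T(y\<^sub>k)\<close> for every integer \<open>k\<close>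
  (lemma \<open>action_mult\<close>). With \<open>y\<^sub>0 = x\<close> and the injectivity of \<open>T\<close> this recursion determines
  the orbit in both directions.
\<close>

lemma int_iterate_unique:
  fixes y :: "int \<Rightarrow> 'a"
  assumes inj: "inj_on T S"
    and mem: "\<And>k. y k \<in> S"
    and step: "\<And>k. y (k + 1) = T (y k)"
  shows "int_iterate S T k (y 0) = y k"
proof -
  have pos: "(T ^^ n) (y 0) = y (int n)" for n
  proof (induction n)
    case (Suc n)
    then show ?case
      using step[of "int n"] by (simp add: add.commute)
  qed simp
  have neg: "(inv_into S T ^^ n) (y 0) = y (- int n)" for n
  proof (induction n)
    case (Suc n)
    have "y (- int n) = T (y (- int (Suc n)))"
      using step[of "- int (Suc n)"] by simp
    then show ?case
      using Suc inv_into_f_f[OF inj mem] by simp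
  qed simp
  show ?thesis
    using pos[of "nat k"] neg[of "nat (- k)"] by (simp add: int_iterate_def)
qed

context bijective_cocycle_datum
begin

abbreviation T :: "'a \<Rightarrow> 'a" where
  "T \<equiv> cocycle_T G \<rho> \<pi>"

abbreviation \<pi>_inv :: "'a \<Rightarrow> 'g" where
  "\<pi>_inv \<equiv> inv_into (carrier G) \<pi>"

lemma \<pi>_closed: "g \<in> carrier G \<Longrightarrow> \<pi> g \<in> carrier A"
  using bij by (rule bij_betw_apply)

lemma \<pi>_inv_closed: "x \<in> carrier A \<Longrightarrow> \<pi>_inv x \<in> carrier G"
  using bij_betw_inv_into[OF bij] by (rule bij_betw_apply)

lemma \<pi>_\<pi>_inv: "x \<in> carrier A \<Longrightarrow> \<pi> (\<pi>_inv x) = x"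
  using bij by (rule bij_betw_inv_into_right)

lemma \<pi>_inv_\<pi>: "g \<in> carrier G \<Longrightarrow> \<pi>_inv (\<pi> g) = g"
  using bij by (rule bij_betw_inv_into_left)

lemma \<rho>_auto: "g \<in> carrier G \<Longrightarrow> \<rho> g \<in> carrier (AutoGroup A)"
  using action by (rule hom_in_carrier)

lemma \<rho>_hom: "g \<in> carrier G \<Longrightarrow> \<rho> g \<in> hom A A"
  using \<rho>_auto by (auto simp: AutoGroup_def auto_def)

lemma \<rho>_closed: "\<lbrakk>g \<in> carrier G; x \<in> carrier A\<rbrakk> \<Longrightarrow> \<rho> g x \<in> carrier A"
  using \<rho>_hom by (rule hom_in_carrier)

lemma \<rho>_mult:
  assumes "g \<in> carrier G" "h \<in> carrier G" "x \<in> carrier A"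
  shows "\<rho> (g \<otimes>\<^bsub>G\<^esub> h) x = \<rho> g (\<rho> h x)"
proof -
  have "\<rho> (g \<otimes>\<^bsub>G\<^esub> h) = \<rho> g \<otimes>\<^bsub>AutoGroup A\<^esub> \<rho> h"
    using action assms by (simp add: hom_mult)
  moreover have "\<rho> g \<in> Bij (carrier A)" "\<rho> h \<in> Bij (carrier A)"
    using \<rho>_auto assms by (auto simp: AutoGroup_def auto_def)
  ultimately show ?thesis
    using assms(3) by (simp add: AutoGroup_def BijGroup_def compose_eq)
qed

lemma \<rho>_one:
  assumes "x \<in> carrier A"
  shows "\<rho> \<one>\<^bsub>G\<^esub> x = x"
proof -
  have "\<rho> \<one>\<^bsub>G\<^esub> = \<one>\<^bsub>AutoGroup A\<^esub>"
    using hom_one[OF action G.is_group A.AutoGroup] .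
  then show ?thesis
    using assms by (simp add: AutoGroup_def BijGroup_def)
qed

lemma inv_\<rho>:
  assumes "g \<in> carrier G"
  shows "inv\<^bsub>AutoGroup A\<^esub> (\<rho> g) = \<rho> (inv\<^bsub>G\<^esub> g)"
proof -
  interpret group_hom G "AutoGroup A" \<rho>
    using action A.AutoGroup by (simp add: group_hom_def group_hom_axioms_def)
  show ?thesis
    using assms by simp
qed

lemma \<pi>_mult:
  assumes "g \<in> carrier G" "h \<in> carrier G"
  shows "\<pi> (g \<otimes>\<^bsub>G\<^esub> h) = \<rho> (inv\<^bsub>G\<^esub> h) (\<pi> g) \<otimes>\<^bsub>A\<^esub> \<pi> h"
  using cocycle[OF assms] inv_\<rho>[OF assms(2)] by simp

lemma \<pi>_one: "\<pi> \<one>\<^bsub>G\<^esub> = \<one>\<^bsub>A\<^esub>"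
  using \<pi>_mult[of "\<one>\<^bsub>G\<^esub>" "\<one>\<^bsub>G\<^esub>"] \<pi>_closed[of "\<one>\<^bsub>G\<^esub>"]
  by (simp add: \<rho>_one)

lemma T_\<pi>: "g \<in> carrier G \<Longrightarrow> T (\<pi> g) = \<rho> g (\<pi> g)"
  by (simp add: cocycle_T_def \<pi>_inv_\<pi>)

text \<open>Expand \<open>\<pi>(g g\<^sup>-\<^sup>1) = 0\<close> by the cocycle identity.\<close>

lemma T_\<pi>_eq_inv:
  assumes "g \<in> carrier G"
  shows "T (\<pi> g) = inv\<^bsub>A\<^esub> \<pi> (inv\<^bsub>G\<^esub> g)"
proof -
  have "\<rho> g (\<pi> g) \<otimes>\<^bsub>A\<^esub> \<pi> (inv\<^bsub>G\<^esub> g) = \<one>\<^bsub>A\<^esub>"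
    using \<pi>_mult[of g "inv\<^bsub>G\<^esub> g"] assms by (simp add: \<pi>_one)
  then show ?thesis
    using assms by (simp add: T_\<pi> \<rho>_closed \<pi>_closed A.inv_equality)
qed

lemma bij_T: "bij_betw T (carrier A) (carrier A)"
proof -
  have inv_G: "bij_betw (\<lambda>g. inv\<^bsub>G\<^esub> g) (carrier G) (carrier G)"
    by (rule bij_betwI[where g = "\<lambda>g. inv\<^bsub>G\<^esub> g"]) auto
  have inv_A: "bij_betw (\<lambda>x. inv\<^bsub>A\<^esub> x) (carrier A) (carrier A)"
    by (rule bij_betwI[where g = "\<lambda>x. inv\<^bsub>A\<^esub> x"]) auto
  have "bij_betw ((\<lambda>x. inv\<^bsub>A\<^esub> x) \<circ> (\<pi> \<circ> ((\<lambda>g. inv\<^bsub>G\<^esub> g) \<circ> \<pi>_inv))) (carrier A) (carrier A)"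
    by (intro bij_betw_trans[OF _ inv_A] bij_betw_trans[OF _ bij]
        bij_betw_trans[OF _ inv_G] bij_betw_inv_into[OF bij])
  moreover have "((\<lambda>x. inv\<^bsub>A\<^esub> x) \<circ> (\<pi> \<circ> ((\<lambda>g. inv\<^bsub>G\<^esub> g) \<circ> \<pi>_inv))) x = T x"
    if "x \<in> carrier A" for x
    using T_\<pi>_eq_inv[OF \<pi>_inv_closed[OF that]] that by (simp add: \<pi>_\<pi>_inv)
  ultimately show ?thesis
    by (simp cong: bij_betw_cong)
qed

text \<open>
  The factor \<open>\<rho>(h)\<close> in the first argument undoes the twist \<open>\<rho>(h)\<^sup>-\<^sup>1\<close> of the cocycle identity.
\<close>

lemma \<pi>_inv_mult:
  assumes "x \<in> carrier A" "h \<in> carrier G"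
  shows "\<pi>_inv (x \<otimes>\<^bsub>A\<^esub> \<pi> h) = \<pi>_inv (\<rho> h x) \<otimes>\<^bsub>G\<^esub> h"
proof -
  have y: "\<rho> h x \<in> carrier A"
    using assms by (simp add: \<rho>_closed)
  have "\<rho> (inv\<^bsub>G\<^esub> h) (\<rho> h x) = x"
    using \<rho>_mult[of "inv\<^bsub>G\<^esub> h" h x] assms by (simp add: \<rho>_one)
  then have "\<pi> (\<pi>_inv (\<rho> h x) \<otimes>\<^bsub>G\<^esub> h) = x \<otimes>\<^bsub>A\<^esub> \<pi> h"
    using \<pi>_mult[OF \<pi>_inv_closed[OF y] assms(2)] y by (simp add: \<pi>_\<pi>_inv)
  then show ?thesis
    using \<pi>_inv_\<pi>[of "\<pi>_inv (\<rho> h x) \<otimes>\<^bsub>G\<^esub> h"] assms(2) \<pi>_inv_closed[OF y] by simp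
qed

text \<open>
  Adding \<open>x\<close> to the index \<open>b\<close> of \<open>\<rho>(\<pi>\<^sup>-\<^sup>1(b))(x)\<close> amounts to applying \<open>T\<close>; for
  \<open>b = k x\<close> this is the recursion along the multiples of \<open>x\<close>.
\<close>

lemma action_mult:
  assumes x: "x \<in> carrier A" and b: "b \<in> carrier A"
  shows "\<rho> (\<pi>_inv (x \<otimes>\<^bsub>A\<^esub> b)) x = T (\<rho> (\<pi>_inv b) x)"
proof -
  have h: "\<pi>_inv b \<in> carrier G"
    using b by (rule \<pi>_inv_closed)
  have "\<pi>_inv (x \<otimes>\<^bsub>A\<^esub> b) = \<pi>_inv (\<rho> (\<pi>_inv b) x) \<otimes>\<^bsub>G\<^esub> \<pi>_inv b"
    using \<pi>_inv_mult[OF x h] b by (simp add: \<pi>_\<pi>_inv)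
  then show ?thesis
    using \<rho>_mult[OF \<pi>_inv_closed[OF \<rho>_closed[OF h x]] h x] by (simp add: cocycle_T_def)
qed

lemma action_int_pow:
  assumes x: "x \<in> carrier A"
  shows "\<rho> (\<pi>_inv (x [^]\<^bsub>A\<^esub> (k :: int))) x = int_iterate (carrier A) T k x"
proof -
  define y where "y k = \<rho> (\<pi>_inv (x [^]\<^bsub>A\<^esub> k)) x" for k :: int
  have "y 0 = x"
    using x \<pi>_inv_\<pi>[OF G.one_closed] by (simp add: y_def \<pi>_one \<rho>_one)
  moreover have "int_iterate (carrier A) T k (y 0) = y k"
  proof (rule int_iterate_unique)
    show "inj_on T (carrier A)"
      using bij_T by (rule bij_betw_imp_inj_on)
    show "y k \<in> carrier A" for k
      using x by (simp add: y_def \<rho>_closed \<pi>_inv_closed)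
    show "y (k + 1) = T (y k)" for k
    proof -
      have "x [^]\<^bsub>A\<^esub> (k + 1) = x \<otimes>\<^bsub>A\<^esub> x [^]\<^bsub>A\<^esub> k"
        using x A.int_pow_mult[of x 1 k] by (simp add: add.commute)
      then show ?thesis
        using action_mult[OF x A.int_pow_closed[OF x]] by (simp add: y_def)
    qed
  qed
  ultimately show ?thesis
    by (simp add: y_def)
qed

lemma T_int_pow:
  assumes x: "x \<in> carrier A"
  shows "T (x [^]\<^bsub>A\<^esub> (k :: int)) = int_iterate (carrier A) T k x [^]\<^bsub>A\<^esub> k"
proof -
  have "T (x [^]\<^bsub>A\<^esub> k) = \<rho> (\<pi>_inv (x [^]\<^bsub>A\<^esub> k)) x [^]\<^bsub>A\<^esub> k"
    unfolding cocycle_T_def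
    using x \<rho>_hom[OF \<pi>_inv_closed[OF A.int_pow_closed[OF x]]]
    by (intro hom_int_pow) auto
  then show ?thesis
    using action_int_pow[OF x] by simp
qed

end

theorem theoremA2:
  fixes G :: "('g, 'c) monoid_scheme" and A :: "('a, 'd) monoid_scheme"
    and \<rho> :: "'g \<Rightarrow> 'a \<Rightarrow> 'a" and \<pi> :: "'g \<Rightarrow> 'a"
  assumes "bijective_cocycle_datum G A \<rho> \<pi>"
  shows "T_structure A (cocycle_T G \<rho> \<pi>)"
proof -
  interpret bijective_cocycle_datum G A \<rho> \<pi>
    by (rule assms)
  show ?thesis
    by unfold_locales (fact bij_T, fact T_int_pow)
qed

end
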